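(* Let $k$ be a field of characteristic zero, and let $\Delta$ be a simplicial complex with no facet of cardinality one. If $\Delta$ is a simplicial forest, then $\Delta$ is levelable.
   Context: A simplicial complex $\Delta$ on $V=\{x_1,\ldots,x_n\}$ ($n\ge1$) is a collection of subsets of $V$ (faces) closed under taking subsets and with $\{x_i\}\in\Delta$ for all $i$; its facets are its faces that are maximal under inclusion. A facet $F$ of $\Delta$ is a leaf if either $F$ is the only facet of $\Delta$, or there exists a facet $G\neq F$ such that for all facets $G'$ of $\Delta$ with $G'\neq F$ one has $G'\cap F\subseteq G\cap F$. $\Delta$ is a (simplicial) forest if every simplicial complex generated by a nonempty sub-collection of the facets of $\Delta$ (i.e. the complex of all subsets of these facets, on the union of these facets as vertex set) has a leaf. Let $R=k[x_1,\ldots,x_n]$ with $\deg x_i=1$. The Stanley-Reisner ideal is $I_\Delta=(x_{i_1}\cdots x_{i_s} \mid \{x_{i_1},\ldots,x_{i_s}\}\notin\Delta)\subseteq R$ (squarefree monomials). For integers $a_i\ge 2$, set $A(\Delta,a_1,\ldots,a_n)=R/(I_\Delta+(x_1^{a_1},\ldots,x_n^{a_n}))$, a graded artinian algebra. For a graded artinian algebra $A=R/I$, $\operatorname{soc}(A)=\{a\in A\mid a\overline{x}_i=0 \text{ for all } i\}$, and the socle-vector is $s(A)=(s_0,\ldots,s_e)$ with $s_i=\dim_k \operatorname{soc}(A)_i$, where $e$ is the largest index with $A_e\neq 0$. $A$ is level if $s_i=0$ for all $i\neq e$. $\Delta$ is levelable if there exists a tuple $(a_1,\ldots,a_n)$ of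 integers, each $a_i\ge 2$, such that $A(\Delta,a_1,\ldots,a_n)$ is level. *)

theory Defs
  imports
    "HOL-Library.Poly_Mapping"
    "HOL-Algebra.Algebraic_Closure_Type"
    "HOL-Algebra.Embedded_Algebras"
    "HOL-Algebra.QuotRing"
begin

section \<open>Simplicial complexes and forests\<close>

definition simplicial_complex :: "'x set \<Rightarrow> 'x set set \<Rightarrow> bool" where
  "simplicial_complex V \<Delta> \<longleftrightarrow>
     finite V \<and> V \<noteq> {} \<and>
     (\<forall>F\<in>\<Delta>. F \<subseteq> V) \<and>
     (\<forall>F\<in>\<Delta>. \<forall>G. G \<subseteq> F \<longrightarrow> G \<in> \<Delta>) \<and>
     (\<forall>x\<in>V. {x} \<in> \<Delta>)"

definition facets :: "'x set set \<Rightarrow> 'x set set" where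
  "facets \<Delta> = {F \<in> \<Delta>. \<forall>G\<in>\<Delta>. F \<subseteq> G \<longrightarrow> G = F}"

definition generated_complex :: "'x set set \<Rightarrow> 'x set set" where
  "generated_complex S = {F. \<exists>G\<in>S. F \<subseteq> G}"

definition is_leaf :: "'x set set \<Rightarrow> 'x set \<Rightarrow> bool" where
  "is_leaf \<Delta> F \<longleftrightarrow>
     F \<in> facets \<Delta> \<and>
     (facets \<Delta> = {F} \<or>
      (\<exists>G\<in>facets \<Delta>. G \<noteq> F \<and>
         (\<forall>G'\<in>facets \<Delta>. G' \<noteq> F \<longrightarrow> G' \<inter> F \<subseteq> G \<inter> F)))"

definition simplicial_forest :: "'x set set \<Rightarrow> bool" where
  "simplicial_forest \<Delta> \<longleftrightarrow>
     (\<forall>S. S \<subseteq> facets \<Delta> \<and> S \<noteq> {} \<longrightarrow> (\<exists>F. is_leaf (generated_complex S) F))"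

section \<open>Polynomials with variables indexed by a finite type\<close>

text \<open>A monomial is its exponent vector, and a polynomial is a finitely supported function from
  monomials to coefficients; multiplication in \<^theory>\<open>HOL-Library.Poly_Mapping\<close> is convolution.\<close>

type_synonym ('x, 'k) mpoly = "('x \<Rightarrow>\<^sub>0 nat) \<Rightarrow>\<^sub>0 'k"

abbreviation poly_ring :: "('x, 'k::comm_ring_1) mpoly ring" where
  "poly_ring \<equiv> ring_of_type_algebra"

definition const_poly :: "'k \<Rightarrow> ('x, 'k::comm_ring_1) mpoly" where
  "const_poly c = Poly_Mapping.single 0 c"

definition var :: "'x \<Rightarrow> ('x, 'k::comm_ring_1) mpoly" where
  "var x = Poly_Mapping.single (Poly_Mapping.single x 1) 1"

definition monomial_degree :: "('x \<Rightarrow>\<^sub>0 nat) \<Rightarrow> nat" where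
  "monomial_degree m = (\<Sum>x\<in>Poly_Mapping.keys m. Poly_Mapping.lookup m x)"

text \<open>The homogeneous component of degree \<open>d\<close>, which includes the zero polynomial.\<close>

definition homogeneous_polys :: "nat \<Rightarrow> ('x, 'k::comm_ring_1) mpoly set" where
  "homogeneous_polys d = {p. \<forall>m\<in>Poly_Mapping.keys p. monomial_degree m = d}"

section \<open>Graded quotients of the polynomial ring and their socles\<close>

text \<open>The algebra \<open>A = R/I\<close> is presented by the ideal \<open>I\<close>, since the grading, the classes of the
  variables and the copy of \<open>k\<close> inside \<open>A\<close> all come from the map \<open>R \<rightarrow> R/I\<close>.
  The definitions below have their usual meaning when \<open>I\<close> is a proper homogeneous ideal with
  artinian quotient.\<close>

abbreviation quotient_algebra :: "('x, 'k::comm_ring_1) mpoly set \<Rightarrow> ('x, 'k) mpoly set ring" where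
  "quotient_algebra I \<equiv> poly_ring Quot I"

abbreviation residue_class ::
    "('x, 'k::comm_ring_1) mpoly set \<Rightarrow> ('x, 'k) mpoly \<Rightarrow> ('x, 'k) mpoly set" where
  "residue_class I p \<equiv> I +>\<^bsub>poly_ring\<^esub> p"

definition graded_component ::
    "('x, 'k::comm_ring_1) mpoly set \<Rightarrow> nat \<Rightarrow> ('x, 'k) mpoly set set" where
  "graded_component I d = residue_class I ` homogeneous_polys d"

definition scalars :: "('x, 'k::comm_ring_1) mpoly set \<Rightarrow> ('x, 'k) mpoly set set" where
  "scalars I = residue_class I ` range const_poly"

definition socle :: "('x, 'k::comm_ring_1) mpoly set \<Rightarrow> ('x, 'k) mpoly set set" where
  "socle I = {a \<in> carrier (quotient_algebra I).
     \<forall>x. a \<otimes>\<^bsub>quotient_algebra I\<^esub> residue_class I (var x) = \<zero>\<^bsub>quotient_algebra I\<^esub>}"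

definition top_degree :: "('x, 'k::comm_ring_1) mpoly set \<Rightarrow> nat" where
  "top_degree I = (GREATEST d. graded_component I d \<noteq> {\<zero>\<^bsub>quotient_algebra I\<^esub>})"

text \<open>The dimension is the one over the subfield \<^const>\<open>scalars\<close> of \<open>A\<close>, i.e. over \<open>k\<close>.\<close>

definition socle_vector :: "('x, 'k::field) mpoly set \<Rightarrow> nat list" where
  "socle_vector I =
     map (\<lambda>i. (ring.dim (quotient_algebra I) over scalars I) (socle I \<inter> graded_component I i))
       [0..<Suc (top_degree I)]"

definition level :: "('x, 'k::field) mpoly set \<Rightarrow> bool" where
  "level I \<longleftrightarrow> (\<forall>i\<le>top_degree I. i \<noteq> top_degree I \<longrightarrow> socle_vector I ! i = 0)"

section \<open>Levelable complexes\<close>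

definition stanley_reisner_ideal :: "'x::finite set set \<Rightarrow> ('x, 'k::comm_ring_1) mpoly set" where
  "stanley_reisner_ideal \<Delta> = Idl\<^bsub>poly_ring\<^esub> {\<Prod>x\<in>S. var x | S. S \<notin> \<Delta>}"

definition A_ideal :: "'x::finite set set \<Rightarrow> ('x \<Rightarrow> nat) \<Rightarrow> ('x, 'k::comm_ring_1) mpoly set" where
  "A_ideal \<Delta> a =
     stanley_reisner_ideal \<Delta> <+>\<^bsub>poly_ring\<^esub> (Idl\<^bsub>poly_ring\<^esub> (range (\<lambda>x. var x ^ a x)))"

text \<open>The type argument fixes the coefficient field.\<close>

definition levelable :: "'k::field itself \<Rightarrow> 'x::finite set set \<Rightarrow> bool" where
  "levelable _ \<Delta> \<longleftrightarrow> (\<exists>a. (\<forall>x. a x \<ge> 2) \<and> level (A_ideal \<Delta> a :: ('x, 'k) mpoly set))"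

end

theory Submission
  imports Defs
begin

text \<open>The ideal of the algebra \<open>A(\<Delta>, a)\<close> is a monomial ideal, so its socle is spanned by monomials,
  namely by the monomials supported on a facet \<open>F\<close> with exponent \<open>a\<^sub>x - 1\<close> at each \<open>x \<in> F\<close>. Hence the
  algebra is level if the sums of \<open>b\<^sub>x = a\<^sub>x - 1\<close> over the facets all agree. For a forest such
  positive weights are built by adding a leaf \<open>F\<close> to the remaining facets: \<open>F\<close> meets them inside
  a proper subset of another facet \<open>G\<close>, so the weight missing on \<open>F\<close> is positive, and after
  multiplying all old weights by \<open>card (F - G)\<close> it can be distributed over the free vertices of
  \<open>F\<close>.\<close>

section \<open>Weights with constant facet sums\<close>

text \<open>A face containing a member of the antichain lies inside some member, and the two members
  then coincide. This lets the leaf condition on a subcollection of facets be read as a condition on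
  that subcollection.\<close>

lemma facets_generated_complex:
  assumes "\<And>F G. F \<in> S \<Longrightarrow> G \<in> S \<Longrightarrow> F \<subseteq> G \<Longrightarrow> F = G"
  shows "facets (generated_complex S) = S"
proof (intro equalityI subsetI)
  fix F assume F: "F \<in> facets (generated_complex S)"
  then obtain G where G: "G \<in> S" "F \<subseteq> G"
    unfolding facets_def generated_complex_def by blast
  then have "G \<in> generated_complex S" unfolding generated_complex_def by blast
  then have "G = F" using F G(2) unfolding facets_def by blast
  with G(1) show "F \<in> S" by simp
next
  fix F assume F: "F \<in> S"
  have "G = F" if G: "G \<in> generated_complex S" "F \<subseteq> G" for G
  proof -
    obtain H where H: "H \<in> S" "G \<subseteq> H" using G(1) unfolding generated_complex_def by blast
    then have "F = H" by (intro assms F order_trans[OF G(2)])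
    then show ?thesis using G(2) H(2) by blast
  qed
  moreover have "F \<in> generated_complex S" using F unfolding generated_complex_def by blast
  ultimately show "F \<in> facets (generated_complex S)" unfolding facets_def by simp
qed

text \<open>The old sets in \<open>S\<close> avoid \<open>F - G\<close>, so the weights there can be
  changed freely. Scaling by \<open>t\<close> makes the weight missing on \<open>F\<close> at least
  \<open>t\<close>, enough to give each of the \<open>t\<close> free vertices a positive
  share.\<close>

lemma balanced_weight_extend:
  fixes b :: "'x \<Rightarrow> nat"
  assumes "finite F" "finite G" "F \<inter> G \<subset> G" "\<not> F \<subseteq> G" "\<And>x. b x \<ge> 1" "sum b G = c"
    and "\<And>H. H \<in> S \<Longrightarrow> H \<inter> F \<subseteq> G" "\<And>H. H \<in> S \<Longrightarrow> sum b H = c"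
  obtains b' :: "'x \<Rightarrow> nat" and c' where "\<And>x. b' x \<ge> 1" "\<And>H. H \<in> insert F S \<Longrightarrow> sum b' H = c'"
proof -
  define t where "t = card (F - G)"
  obtain x0 where x0: "x0 \<in> F - G" using assms(4) by auto
  have t: "t \<ge> 1"
    unfolding t_def using assms(1) x0 by (metis One_nat_def Suc_leI card_gt_0_iff empty_iff finite_Diff)
  define s where "s = sum b (F \<inter> G)"
  \<comment> \<open>The positive weight of a vertex of \<open>G\<close> outside \<open>F\<close>
    makes the inequality \<open>s < c\<close> strict.\<close>
  obtain y where "y \<in> G" "y \<notin> F \<inter> G" using assms(3) by auto
  then have "sum b (insert y (F \<inter> G)) \<le> sum b G"
    using assms(2) by (intro sum_mono2) auto
  moreover have "sum b (insert y (F \<inter> G)) = b y + s"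
    unfolding s_def using assms(1) \<open>y \<notin> F \<inter> G\<close> by (intro sum.insert) auto
  ultimately have "s < c" using assms(5)[of y] assms(6) by linarith
  then have tc: "t * (c - s) \<ge> t" "t * (c - s) = t * c - t * s"
    using mult_le_mono2[of 1 "c - s" t] by (simp_all add: diff_mult_distrib2)
  \<comment> \<open>Every free vertex except \<open>x0\<close> gets weight 1 and \<open>x0\<close>
    absorbs the rest, so \<open>F - G\<close> weighs \<open>t * (c - s)\<close> in total. The new
    common sum is \<open>t * c\<close>.\<close>
  define b' where "b' x = (if x \<in> F - G then if x = x0 then t * (c - s) - (t - 1) else 1
    else t * b x)" for x
  have "b' x \<ge> 1" for x
    using t tc assms(5)[of x] unfolding b'_def by (auto simp: Suc_le_eq)
  moreover have "sum b' H = t * c" if "H \<in> insert F S" for H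
  proof (cases "H \<in> S")
    case True
    have "sum b' H = (\<Sum>x\<in>H. t * b x)"
      using assms(7)[OF True] by (intro sum.cong) (auto simp: b'_def)
    then show ?thesis using assms(8)[OF True] by (metis sum_distrib_left)
  next
    case False
    then have "H = F" using that by simp
    have "sum b' F = sum b' (F \<inter> G) + sum b' (F - G)"
      using assms(1) by (metis sum.Int_Diff)
    moreover have "sum b' (F \<inter> G) = (\<Sum>x\<in>F \<inter> G. t * b x)"
      by (intro sum.cong) (auto simp: b'_def)
    moreover have "sum b' (F - G) = b' x0 + sum b' (F - G - {x0})"
      using assms(1) x0 by (intro sum.remove) auto
    moreover have "sum b' (F - G - {x0}) = (\<Sum>x\<in>F - G - {x0}. 1)"
      by (intro sum.cong) (auto simp: b'_def)
    moreover have "card (F - G - {x0}) = t - 1"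
      unfolding t_def using assms(1) x0 by simp
    moreover have "b' x0 = t * (c - s) - (t - 1)" using x0 by (simp add: b'_def)
    ultimately have "sum b' F = t * s + (t * (c - s) - (t - 1) + (t - 1))"
      by (simp add: s_def sum_distrib_left)
    moreover have "t * s \<le> t * c" using \<open>s < c\<close> by simp
    ultimately show ?thesis using tc unfolding \<open>H = F\<close> by linarith
  qed
  ultimately show ?thesis using that by blast
qed

text \<open>Induction on \<open>S\<close>, removing a leaf. An arbitrary antichain is used instead
  of the facets of a fixed complex, so that both hypotheses pass to \<open>S - {F}\<close>.\<close>

lemma balanced_weight_exists:
  fixes S :: "'x::finite set set"
  assumes "\<And>F G. F \<in> S \<Longrightarrow> G \<in> S \<Longrightarrow> F \<subseteq> G \<Longrightarrow> F = G"
    and "\<And>T. T \<subseteq> S \<Longrightarrow> T \<noteq> {} \<Longrightarrow> \<exists>F. is_leaf (generated_complex T) F"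
  shows "\<exists>(b :: 'x \<Rightarrow> nat) c. (\<forall>x. b x \<ge> 1) \<and> (\<forall>F\<in>S. sum b F = c)"
proof -
  have "finite S" by simp
  then show ?thesis using assms
  proof (induction S rule: finite_psubset_induct)
    case (psubset S)
    show ?case
    proof (cases "S = {}")
      case True
      then show ?thesis by (intro exI[of _ "\<lambda>_. 1"]) auto
    next
      case False
      then obtain F where "is_leaf (generated_complex S) F" using psubset.prems(2) by blast
      then have F: "F \<in> S" and
        leaf: "S = {F} \<or> (\<exists>G\<in>S. G \<noteq> F \<and> (\<forall>G'\<in>S. G' \<noteq> F \<longrightarrow> G' \<inter> F \<subseteq> G \<inter> F))"
        using facets_generated_complex[OF psubset.prems(1)] unfolding is_leaf_def by auto
      show ?thesis
      proof (cases "S = {F}")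
        case True
        then show ?thesis by (intro exI[of _ "\<lambda>_. 1"]) auto
      next
        case False
        then obtain G where G: "G \<in> S" "G \<noteq> F" "\<And>G'. G' \<in> S - {F} \<Longrightarrow> G' \<inter> F \<subseteq> G"
          using leaf by blast
        have "\<exists>(b :: 'x \<Rightarrow> nat) c. (\<forall>x. b x \<ge> 1) \<and> (\<forall>F\<in>S - {F}. sum b F = c)"
        proof (rule psubset.IH)
          show "S - {F} \<subset> S" using F by blast
          show "H = G" if "H \<in> S - {F}" "G \<in> S - {F}" "H \<subseteq> G" for H G
            using that by (intro psubset.prems(1)) auto
          show "\<exists>H. is_leaf (generated_complex T) H" if "T \<subseteq> S - {F}" "T \<noteq> {}" for T
            using that by (intro psubset.prems(2)) auto
        qed
        then obtain b :: "'x \<Rightarrow> nat" and c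
          where b: "\<And>x. b x \<ge> 1" "\<And>H. H \<in> S - {F} \<Longrightarrow> sum b H = c" by blast
        \<comment> \<open>Neither of two distinct members of an antichain contains the other:
          \<open>F\<close> has a free vertex, and \<open>G\<close> has a vertex outside
          \<open>F\<close>.\<close>
        have "\<not> F \<subseteq> G" "\<not> G \<subseteq> F"
          using psubset.prems(1)[OF F G(1)] psubset.prems(1)[OF G(1) F] G(2) by auto
        then have "\<not> F \<subseteq> G" "F \<inter> G \<subset> G" by auto
        moreover have "sum b G = c" using b(2) G by blast
        ultimately obtain b' :: "'x \<Rightarrow> nat" and c' where
          "\<And>x. b' x \<ge> 1" "\<And>H. H \<in> insert F (S - {F}) \<Longrightarrow> sum b' H = c'"
          using balanced_weight_extend[OF finite finite _ _ b(1) _ G(3) b(2)] by metis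
        then show ?thesis using F by (intro exI[of _ b'] exI[of _ c']) auto
      qed
    qed
  qed
qed

section \<open>Monomial ideals\<close>

lemma poly_ring_simps [simp]:
  "carrier poly_ring = UNIV"
  "x \<oplus>\<^bsub>poly_ring\<^esub> y = x + y"
  "x \<otimes>\<^bsub>poly_ring\<^esub> y = x * y"
  "\<zero>\<^bsub>poly_ring\<^esub> = 0"
  "\<one>\<^bsub>poly_ring\<^esub> = 1"
  by (simp_all add: ring_of_type_algebra_def)

lemma ring_poly_ring: "ring (poly_ring :: ('x, 'k::comm_ring_1) mpoly ring)"
  by (rule ring_from_type_algebra)

lemma a_inv_poly_ring [simp]:
  fixes p :: "('x, 'k::comm_ring_1) mpoly"
  shows "\<ominus>\<^bsub>poly_ring\<^esub> p = - p"
proof -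
  interpret R: ring "poly_ring :: ('x, 'k) mpoly ring" by (rule ring_poly_ring)
  show ?thesis by (rule R.minus_equality) simp_all
qed

text \<open>Every exponent of a product is a sum of exponents of the factors, so stability of
  \<open>B\<close> under adding arbitrary exponents yields closure under multiplication.\<close>

lemma ideal_keys_subset:
  assumes "\<And>m n. m \<in> B \<Longrightarrow> m + n \<in> B"
  shows "ideal {p :: ('x, 'k::comm_ring_1) mpoly. Poly_Mapping.keys p \<subseteq> B} poly_ring"
proof (rule idealI[OF ring_poly_ring])
  interpret R: ring "poly_ring :: ('x, 'k) mpoly ring" by (rule ring_poly_ring)
  show "subgroup {p. Poly_Mapping.keys p \<subseteq> B} (add_monoid (poly_ring :: ('x, 'k) mpoly ring))"
  proof (rule R.add.subgroupI)
    show "a \<oplus>\<^bsub>poly_ring\<^esub> b \<in> {p. Poly_Mapping.keys p \<subseteq> B}"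
      if "a \<in> {p. Poly_Mapping.keys p \<subseteq> B}" "b \<in> {p. Poly_Mapping.keys p \<subseteq> B}"
      for a b :: "('x, 'k) mpoly"
      using that Poly_Mapping.keys_add[of a b] by auto
  qed (auto intro!: exI[of _ 0])
  fix p q :: "('x, 'k) mpoly"
  assume p: "p \<in> {p. Poly_Mapping.keys p \<subseteq> B}"
  have "Poly_Mapping.keys (p * q) \<subseteq> B"
    using keys_mult[of p q] p assms by blast
  then show "p \<otimes>\<^bsub>poly_ring\<^esub> q \<in> {p. Poly_Mapping.keys p \<subseteq> B}"
    "q \<otimes>\<^bsub>poly_ring\<^esub> p \<in> {p. Poly_Mapping.keys p \<subseteq> B}"
    by (simp_all add: mult.commute)
qed

lemma sum_single_keys:
  "(\<Sum>m\<in>Poly_Mapping.keys p. Poly_Mapping.single m (Poly_Mapping.lookup p m)) = p"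
  by (rule poly_mapping_eqI) (simp add: lookup_sum lookup_single when_def in_keys_iff)

lemma ideal_poly_ringD:
  fixes I :: "('x, 'k::comm_ring_1) mpoly set"
  assumes "ideal I poly_ring"
  shows "0 \<in> I" "p \<in> I \<Longrightarrow> q \<in> I \<Longrightarrow> p + q \<in> I" "p \<in> I \<Longrightarrow> p * q \<in> I"
proof -
  interpret ideal I poly_ring by fact
  show "0 \<in> I" "p \<in> I \<Longrightarrow> q \<in> I \<Longrightarrow> p + q \<in> I" "p \<in> I \<Longrightarrow> p * q \<in> I"
    using additive_subgroup.zero_closed[OF is_additive_subgroup]
      additive_subgroup.a_closed[OF is_additive_subgroup] I_r_closed by auto
qed

lemma mem_ideal_if_monomials:
  fixes p :: "('x, 'k::comm_ring_1) mpoly"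
  assumes "ideal I poly_ring"
    and "\<And>m. m \<in> Poly_Mapping.keys p \<Longrightarrow> Poly_Mapping.single m 1 \<in> I"
  shows "p \<in> I"
proof -
  \<comment> \<open>Generalised from all terms of \<open>p\<close> to any subset of them, so that
    induction on \<open>M\<close> applies.\<close>
  have "(\<Sum>m\<in>M. Poly_Mapping.single m (Poly_Mapping.lookup p m)) \<in> I"
    if "M \<subseteq> Poly_Mapping.keys p" "finite M" for M
    using that(2,1)
  proof (induction M rule: finite_induct)
    case empty
    then show ?case using ideal_poly_ringD(1)[OF assms(1)] by simp
  next
    case (insert m M)
    have "Poly_Mapping.single m 1 * Poly_Mapping.single 0 (Poly_Mapping.lookup p m) \<in> I"
      using insert.prems by (intro ideal_poly_ringD(3)[OF assms(1)] assms(2)) auto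
    then have "Poly_Mapping.single m (Poly_Mapping.lookup p m) \<in> I" by (simp add: mult_single)
    with insert show ?case using ideal_poly_ringD(2)[OF assms(1)] by simp
  qed
  from this[OF subset_refl] show ?thesis by (simp add: sum_single_keys)
qed

lemma prod_var:
  "(\<Prod>x\<in>S. var x) = (Poly_Mapping.single (\<Sum>x\<in>S. Poly_Mapping.single x 1) 1
     :: ('x, 'k::comm_ring_1) mpoly)"
  by (induction S rule: infinite_finite_induct) (simp_all add: var_def mult_single)

lemma var_power:
  "var x ^ n = (Poly_Mapping.single (Poly_Mapping.single x n) 1 :: ('x, 'k::comm_ring_1) mpoly)"
  by (induction n) (simp_all add: var_def mult_single flip: single_add)

text \<open>Monomial divisibility: since \<open>k\<close> is pointwise below \<open>m\<close>, the
  truncated difference \<open>m - k\<close> is the exponent of a genuine cofactor.\<close>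

lemma single_mem_ideal_mono:
  fixes I :: "('x, 'k::comm_ring_1) mpoly set"
  assumes "ideal I poly_ring" "Poly_Mapping.single k 1 \<in> I"
    and "\<And>x. Poly_Mapping.lookup k x \<le> Poly_Mapping.lookup m x"
  shows "Poly_Mapping.single m 1 \<in> I"
proof -
  have "m = k + (m - k)"
    using assms(3) by (intro poly_mapping_eqI) (simp add: lookup_add lookup_minus)
  then have "(Poly_Mapping.single m 1 :: ('x, 'k) mpoly) =
      Poly_Mapping.single k 1 * Poly_Mapping.single (m - k) 1"
    by (metis mult_single mult_1)
  then show ?thesis using ideal_poly_ringD(3)[OF assms(1,2)] by simp
qed

section \<open>Standard monomials of the algebra\<close>

definition standard_exponents :: "'x set set \<Rightarrow> ('x \<Rightarrow> nat) \<Rightarrow> ('x \<Rightarrow>\<^sub>0 nat) set" where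
  "standard_exponents \<Delta> a =
     {m. Poly_Mapping.keys m \<in> \<Delta> \<and> (\<forall>x. Poly_Mapping.lookup m x < a x)}"

lemma ideal_A_ideal: "ideal (A_ideal \<Delta> a :: ('x::finite, 'k::comm_ring_1) mpoly set) poly_ring"
proof -
  interpret R: ring "poly_ring :: ('x, 'k) mpoly ring" by (rule ring_poly_ring)
  show ?thesis unfolding A_ideal_def stanley_reisner_ideal_def
    by (intro R.add_ideals R.genideal_ideal) auto
qed

text \<open>Divisors of standard monomials are standard, because \<open>\<Delta>\<close> is closed
  under subsets; so the right-hand side is an ideal, and it contains all generators. Conversely,
  every nonstandard monomial is divisible by a generator.\<close>

lemma A_ideal_eq:
  assumes down: "\<forall>F\<in>\<Delta>. \<forall>G. G \<subseteq> F \<longrightarrow> G \<in> \<Delta>"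
  shows "(A_ideal \<Delta> a :: ('x::finite, 'k::comm_ring_1) mpoly set) =
    {p. Poly_Mapping.keys p \<subseteq> - standard_exponents \<Delta> a}" (is "_ = ?J")
proof -
  interpret R: ring "poly_ring :: ('x, 'k) mpoly ring" by (rule ring_poly_ring)
  let ?SR = "stanley_reisner_ideal \<Delta> :: ('x, 'k) mpoly set"
  let ?P = "Idl\<^bsub>poly_ring\<^esub> (range (\<lambda>x. var x ^ a x)) :: ('x, 'k) mpoly set"
  have SR: "ideal ?SR poly_ring"
    unfolding stanley_reisner_ideal_def by (intro R.genideal_ideal) auto
  have P: "ideal ?P poly_ring" by (intro R.genideal_ideal) auto
  have J: "ideal ?J poly_ring"
  proof (rule ideal_keys_subset)
    fix m n :: "'x \<Rightarrow>\<^sub>0 nat"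
    assume "m \<in> - standard_exponents \<Delta> a"
    moreover have "Poly_Mapping.keys m \<subseteq> Poly_Mapping.keys (m + n)"
      by (auto simp: in_keys_iff lookup_add)
    moreover have "Poly_Mapping.lookup m x < a x" if "Poly_Mapping.lookup (m + n) x < a x" for x
      using that by (simp add: lookup_add)
    ultimately show "m + n \<in> - standard_exponents \<Delta> a"
      using down unfolding standard_exponents_def by blast
  qed
  have keys_sum_single: "Poly_Mapping.keys (\<Sum>x\<in>S. Poly_Mapping.single x (1::nat)) = S" for S :: "'x set"
    by (auto simp: in_keys_iff lookup_sum lookup_single when_def split: if_splits)
  have "?SR \<subseteq> ?J"
    unfolding stanley_reisner_ideal_def
    by (intro R.genideal_minimal J)
      (auto simp: prod_var keys_sum_single standard_exponents_def simp del: One_nat_def)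
  moreover have "?P \<subseteq> ?J"
  proof (intro R.genideal_minimal J subsetI)
    fix p :: "('x, 'k) mpoly" assume "p \<in> range (\<lambda>x. var x ^ a x)"
    then obtain x where "p = var x ^ a x" by blast
    moreover have "Poly_Mapping.single x (a x) \<notin> standard_exponents \<Delta> a"
      unfolding standard_exponents_def by (auto intro: exI[of _ x])
    ultimately show "p \<in> ?J" by (simp add: var_power)
  qed
  ultimately have "p + q \<in> ?J" if "p \<in> ?SR" "q \<in> ?P" for p q
    using that by (intro ideal_poly_ringD(2)[OF J]) (rule subsetD, assumption+)+
  then have "A_ideal \<Delta> a \<subseteq> ?J"
    unfolding A_ideal_def set_add_def' poly_ring_simps(2) by (intro UN_least) simp
  moreover have sum_mem: "p + q \<in> A_ideal \<Delta> a" if "p \<in> ?SR" "q \<in> ?P" for p q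
    unfolding A_ideal_def set_add_def' by (intro UN_I[OF that(1)] UN_I[OF that(2)]) simp
  moreover have "?J \<subseteq> A_ideal \<Delta> a"
  proof
    fix p :: "('x, 'k) mpoly"
    assume p: "p \<in> ?J"
    show "p \<in> A_ideal \<Delta> a"
    proof (rule mem_ideal_if_monomials[OF ideal_A_ideal])
      fix m assume "m \<in> Poly_Mapping.keys p"
      then have "m \<notin> standard_exponents \<Delta> a" using p by blast
      \<comment> \<open>The two cases match the two families of generators: either the squarefree
        monomial on the support of \<open>m\<close> or the power of \<open>x\<close> with exponent
        \<open>a x\<close> divides the monomial of \<open>m\<close>.\<close>
      then consider "Poly_Mapping.keys m \<notin> \<Delta>" | x where "a x \<le> Poly_Mapping.lookup m x"
        unfolding standard_exponents_def by (auto simp: not_less)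
      then show "(Poly_Mapping.single m 1 :: ('x, 'k) mpoly) \<in> A_ideal \<Delta> a"
      proof cases
        case 1
        then have "(\<Prod>x\<in>Poly_Mapping.keys m. var x) \<in> ?SR"
          unfolding stanley_reisner_ideal_def by (intro subsetD[OF R.genideal_self]) auto
        then have "Poly_Mapping.single m 1 \<in> ?SR"
          unfolding prod_var
          by (rule single_mem_ideal_mono[OF SR])
            (auto simp: lookup_sum lookup_single when_def in_keys_iff)
        then show ?thesis
          using sum_mem[OF _ ideal_poly_ringD(1)[OF P], of "Poly_Mapping.single m 1"] by simp
      next
        case 2
        have "var x ^ a x \<in> ?P" by (intro subsetD[OF R.genideal_self]) auto
        then have "Poly_Mapping.single (Poly_Mapping.single x (a x)) 1 \<in> ?P"
          by (simp only: var_power[of x "a x"])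
        then have "Poly_Mapping.single m 1 \<in> ?P"
          by (rule single_mem_ideal_mono[OF P]) (use 2 in \<open>auto simp: lookup_single when_def\<close>)
        then show ?thesis
          using sum_mem[OF ideal_poly_ringD(1)[OF SR], of "Poly_Mapping.single m 1"] by simp
      qed
    qed
  qed
  ultimately show ?thesis by blast
qed

section \<open>Socles of graded quotients\<close>

lemma residue_class_eq_zero_iff:
  fixes I :: "('x, 'k::comm_ring_1) mpoly set"
  assumes "ideal I poly_ring"
  shows "residue_class I p = \<zero>\<^bsub>quotient_algebra I\<^esub> \<longleftrightarrow> p \<in> I"
proof -
  interpret R: ring "poly_ring :: ('x, 'k) mpoly ring" by (rule ring_poly_ring)
  show ?thesis
    using ideal.rcos_const_imp_mem[OF assms, of p] R.a_rcos_zero[OF assms, of p]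
    by (auto simp: FactRing_def)
qed

lemma image_eq_singleton_iff:
  assumes "A \<noteq> {}"
  shows "f ` A = {c} \<longleftrightarrow> (\<forall>x\<in>A. f x = c)"
  using assms by auto

lemma graded_component_eq_zero_iff:
  fixes I :: "('x, 'k::comm_ring_1) mpoly set"
  assumes "ideal I poly_ring"
  shows "graded_component I d = {\<zero>\<^bsub>quotient_algebra I\<^esub>} \<longleftrightarrow> homogeneous_polys d \<subseteq> I"
proof -
  have "homogeneous_polys d \<noteq> ({} :: ('x, 'k) mpoly set)"
    by (auto simp: homogeneous_polys_def intro!: exI[of _ 0])
  then have "graded_component I d = {\<zero>\<^bsub>quotient_algebra I\<^esub>} \<longleftrightarrow>
      (\<forall>p\<in>homogeneous_polys d. residue_class I p = \<zero>\<^bsub>quotient_algebra I\<^esub>)"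
    unfolding graded_component_def by (rule image_eq_singleton_iff)
  then show ?thesis by (simp add: residue_class_eq_zero_iff[OF assms] subset_eq)
qed

text \<open>Turns the socle condition on cosets into a colon condition on polynomials, the form in
  which exponents can be compared.\<close>

lemma residue_class_mem_socle_iff:
  fixes I :: "('x, 'k::comm_ring_1) mpoly set"
  assumes "ideal I poly_ring"
  shows "residue_class I p \<in> socle I \<longleftrightarrow> (\<forall>x. p * var x \<in> I)"
proof -
  interpret ideal I "poly_ring :: ('x, 'k) mpoly ring" by fact
  interpret h: ring_hom_ring poly_ring "quotient_algebra I" "residue_class I"
    by (rule rcos_ring_hom_ring)
  have "residue_class I p \<otimes>\<^bsub>quotient_algebra I\<^esub> residue_class I (var x) =
      residue_class I (p * var x)" for x
    using h.hom_mult[of p "var x"] by simp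
  then show ?thesis
    unfolding socle_def using residue_class_eq_zero_iff[OF assms] h.hom_closed[of p] by simp
qed

text \<open>As \<open>dim\<close> is a definite description, every other dimension of the zero space
  has to be excluded: a line extension by \<open>v\<close> contains \<open>v\<close>, which is
  nonzero.\<close>

lemma (in ring) dim_zero_subspace:
  assumes "\<zero> \<in> K" "\<one> \<in> K"
  shows "(dim over K) {\<zero>} = 0"
proof -
  \<comment> \<open>Membership of zero is carried through the induction because it turns
    \<open>v \<notin> E\<close> into \<open>v \<noteq> \<zero>\<close>.\<close>
  have "\<zero> \<in> E \<and> (n \<noteq> 0 \<longrightarrow> E \<noteq> {\<zero>})" if "dimension n K E" for n E
    using that assms
  proof (induction rule: dimension.induct)
    case (Suc_dim v E n K)
    then have E: "\<zero> \<in> E" by simp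
    have "\<zero> = \<zero> \<otimes> v \<oplus> \<zero>" "v = \<one> \<otimes> v \<oplus> \<zero>" using Suc_dim.hyps(1) by simp_all
    then have "\<zero> \<in> line_extension K v E" "v \<in> line_extension K v E"
      unfolding line_extension_mem_iff using E Suc_dim.prems by blast+
    moreover have "v \<noteq> \<zero>" using Suc_dim.hyps(2) E by blast
    ultimately show ?case by blast
  qed simp
  then show ?thesis
    unfolding over_def dim_def by (intro the_equality) auto
qed

text \<open>It suffices that \<open>D\<close> bounds the top degree from above: each degree below
  the top is then below \<open>D\<close>, where the socle is zero and so has dimension zero.\<close>

lemma levelI:
  fixes I :: "('x, 'k::field) mpoly set"
  assumes I: "ideal I poly_ring"
    and "1 \<notin> I"
    and high: "\<And>d. d > D \<Longrightarrow> homogeneous_polys d \<subseteq> I"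
    and low: "\<And>d p. d < D \<Longrightarrow> p \<in> homogeneous_polys d \<Longrightarrow> \<forall>x. p * var x \<in> I \<Longrightarrow> p \<in> I"
  shows "level I"
proof -
  let ?z = "\<zero>\<^bsub>quotient_algebra I\<^esub>"
  interpret ideal I "poly_ring :: ('x, 'k) mpoly ring" by fact
  interpret Q: ring "quotient_algebra I" by (rule quotient_is_ring)
  have one: "1 \<in> (homogeneous_polys 0 :: ('x, 'k) mpoly set)"
    by (auto simp: homogeneous_polys_def monomial_degree_def simp flip: single_one split: if_splits)
  \<comment> \<open>The greatest degree exists: degree 0 is nonzero since
    \<open>1 \<notin> I\<close>, and the nonzero degrees are bounded by \<open>D\<close>.\<close>
  have "graded_component I (top_degree I) \<noteq> {?z}"
    unfolding top_degree_def
  proof (rule GreatestI_nat)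
    show "graded_component I 0 \<noteq> {?z}"
      using one \<open>1 \<notin> I\<close> graded_component_eq_zero_iff[OF I] by blast
    show "d \<le> D" if "graded_component I d \<noteq> {?z}" for d
      using that high graded_component_eq_zero_iff[OF I] by (meson not_le)
  qed
  then have top: "top_degree I \<le> D"
    using high graded_component_eq_zero_iff[OF I] by (meson not_le)
  have "socle I \<inter> graded_component I i = {?z}" if "i < D" for i
  proof -
    have z: "residue_class I 0 = ?z" "?z \<in> socle I"
      using residue_class_eq_zero_iff[OF I, of 0] residue_class_mem_socle_iff[OF I, of 0]
        ideal_poly_ringD(1)[OF I] by auto
    have "0 \<in> (homogeneous_polys i :: ('x, 'k) mpoly set)" by (simp add: homogeneous_polys_def)
    then have "?z \<in> graded_component I i"
      unfolding graded_component_def by (rule rev_image_eqI) (simp add: z)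
    moreover have "residue_class I p = ?z"
      if "p \<in> homogeneous_polys i" "residue_class I p \<in> socle I" for p
      using low[OF \<open>i < D\<close>] that residue_class_eq_zero_iff[OF I] residue_class_mem_socle_iff[OF I]
      by blast
    then have "c = ?z" if "c \<in> socle I" "c \<in> graded_component I i" for c
      using that unfolding graded_component_def by blast
    ultimately show ?thesis using z by blast
  qed
  moreover have "(Q.dim over scalars I) {?z} = 0"
  proof (rule Q.dim_zero_subspace)
    have "\<one>\<^bsub>quotient_algebra I\<^esub> = residue_class I (const_poly 1)"
      by (simp add: FactRing_def const_poly_def)
    then show "\<one>\<^bsub>quotient_algebra I\<^esub> \<in> scalars I" unfolding scalars_def by blast
    have "?z = residue_class I (const_poly 0)"
      using residue_class_eq_zero_iff[OF I, of 0] ideal_poly_ringD(1)[OF I]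
      by (simp add: const_poly_def)
    then show "?z \<in> scalars I" unfolding scalars_def by blast
  qed
  ultimately show ?thesis
    unfolding level_def socle_vector_def using top by (simp del: upt_Suc)
qed

section \<open>Socle monomials and levelness\<close>

text \<open>Multiplying by a variable shifts exponents injectively, so nothing cancels: in the
  convolution only the exponent of the variable contributes, which forces
  \<open>l = m\<close>.\<close>

lemma lookup_mult_var:
  fixes p :: "('x, 'k::comm_ring_1) mpoly"
  shows "Poly_Mapping.lookup (p * var x) (m + Poly_Mapping.single x 1) = Poly_Mapping.lookup p m"
proof -
  have "(\<Sum>q. (Poly_Mapping.lookup (var x :: ('x, 'k) mpoly) q when
      m + Poly_Mapping.single x 1 = l + q)) = (1 when l = m)" for l
  proof -
    have "(\<Sum>q. (Poly_Mapping.lookup (var x :: ('x, 'k) mpoly) q when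
        m + Poly_Mapping.single x 1 = l + q)) =
      (\<Sum>q. ((1 when l = m) when q = Poly_Mapping.single x (1::nat)))"
      by (intro Sum_any.cong) (auto simp: var_def lookup_single when_def)
    then show ?thesis by simp
  qed
  then show ?thesis by (simp add: lookup_mult mult_when)
qed

text \<open>A standard monomial is supported in a facet, hence has degree at most \<open>D\<close>.
  If all variables kill it, its support is a facet and its exponents are the maximal ones
  \<open>a x - 1\<close>, so its degree equals \<open>D\<close>.\<close>

lemma level_A_ideal:
  fixes \<Delta> :: "'x::finite set set"
  assumes \<Delta>: "simplicial_complex UNIV \<Delta>" and a: "\<And>x. a x \<ge> 2"
    and D: "\<And>F. F \<in> facets \<Delta> \<Longrightarrow> (\<Sum>x\<in>F. a x - 1) = D"
  shows "level (A_ideal \<Delta> a :: ('x, 'k::field) mpoly set)"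
proof -
  let ?I = "A_ideal \<Delta> a :: ('x, 'k) mpoly set"
  have down: "\<forall>F\<in>\<Delta>. \<forall>G. G \<subseteq> F \<longrightarrow> G \<in> \<Delta>" and empty: "{} \<in> \<Delta>"
    using \<Delta> unfolding simplicial_complex_def by (auto)
  have I: "p \<in> ?I \<longleftrightarrow> Poly_Mapping.keys p \<subseteq> - standard_exponents \<Delta> a" for p
    using A_ideal_eq[OF down] by blast
  have lt: "Poly_Mapping.lookup m x \<le> a x - 1" if "m \<in> standard_exponents \<Delta> a" for m x
    using that unfolding standard_exponents_def by (auto dest: spec[of _ x])
  show ?thesis
  proof (rule levelI[OF ideal_A_ideal])
    have "0 \<in> standard_exponents \<Delta> a"
      using empty less_le_trans[OF _ a, of 0] unfolding standard_exponents_def by simp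
    then show "1 \<notin> ?I" unfolding I by simp
  next
    fix d assume "D < d"
    show "homogeneous_polys d \<subseteq> ?I"
    proof
      fix p :: "('x, 'k) mpoly" assume p: "p \<in> homogeneous_polys d"
      have False if m: "m \<in> Poly_Mapping.keys p" "m \<in> standard_exponents \<Delta> a" for m
      proof -
        have "Poly_Mapping.keys m \<in> \<Delta>" using m(2) by (simp add: standard_exponents_def)
        then obtain F where F: "F \<in> \<Delta>" "Poly_Mapping.keys m \<subseteq> F"
            "\<And>G. G \<in> \<Delta> \<Longrightarrow> F \<subseteq> G \<Longrightarrow> F = G"
          using finite_has_maximal2[of \<Delta> "Poly_Mapping.keys m"] by auto
        then have "F \<in> facets \<Delta>" unfolding facets_def by blast
        have "monomial_degree m \<le> (\<Sum>x\<in>Poly_Mapping.keys m. a x - 1)"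
          unfolding monomial_degree_def by (intro sum_mono lt m)
        also have "\<dots> \<le> (\<Sum>x\<in>F. a x - 1)" using F(2) by (intro sum_mono2) auto
        also have "\<dots> = D" by (rule D) fact
        finally show False using p m \<open>D < d\<close> by (auto simp: homogeneous_polys_def)
      qed
      then show "p \<in> ?I" unfolding I by blast
    qed
  next
    fix d and p :: "('x, 'k) mpoly"
    assume d: "d < D" and p: "p \<in> homogeneous_polys d" and soc: "\<forall>x. p * var x \<in> ?I"
    have False if m: "m \<in> Poly_Mapping.keys p" "m \<in> standard_exponents \<Delta> a" for m
    proof -
      \<comment> \<open>The socle condition on \<open>p\<close> passes to each of its monomials,
        since the shifted exponent occurs in \<open>p * var x\<close>.\<close>
      have bad: "m + Poly_Mapping.single x 1 \<notin> standard_exponents \<Delta> a" for x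
      proof -
        have "m + Poly_Mapping.single x 1 \<in> Poly_Mapping.keys (p * var x)"
          using m(1) lookup_mult_var[of p x m] by (simp add: in_keys_iff)
        then show ?thesis using soc unfolding I by blast
      qed
      have face: "Poly_Mapping.keys m \<in> \<Delta>" using m(2) by (simp add: standard_exponents_def)
      have keys: "Poly_Mapping.keys (m + Poly_Mapping.single x 1) = insert x (Poly_Mapping.keys m)"
        for x
        by (auto simp: in_keys_iff lookup_add lookup_single when_def split: if_splits)
      \<comment> \<open>For \<open>x\<close> in the support the shift keeps the support a face, so
        an exponent bound must fail, and it can only fail at \<open>x\<close>.\<close>
      have full: "Poly_Mapping.lookup m x = a x - 1" if x: "x \<in> Poly_Mapping.keys m" for x
      proof -
        obtain y where "a y \<le> Poly_Mapping.lookup (m + Poly_Mapping.single x 1) y"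
          using bad[of x] face x unfolding standard_exponents_def
          by (auto simp: keys insert_absorb not_less simp del: One_nat_def)
        moreover have "Poly_Mapping.lookup m y < a y"
          using m(2) by (simp add: standard_exponents_def)
        ultimately have "y = x" "Poly_Mapping.lookup m y = a y - 1"
          by (auto simp: lookup_add lookup_single when_def split: if_splits)
        then show ?thesis by simp
      qed
      \<comment> \<open>A larger face would contain a new vertex \<open>x\<close>; there the shift
        produces exponent 1, below \<open>a x \<ge> 2\<close>, so the shifted monomial would remain
        standard.\<close>
      have "G = Poly_Mapping.keys m" if G: "G \<in> \<Delta>" "Poly_Mapping.keys m \<subseteq> G" for G
      proof (rule ccontr)
        assume "G \<noteq> Poly_Mapping.keys m"
        with G(2) obtain x where x: "x \<in> G" "x \<notin> Poly_Mapping.keys m" by blast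
        have "insert x (Poly_Mapping.keys m) \<in> \<Delta>" using G x down by blast
        moreover have "Poly_Mapping.lookup (m + Poly_Mapping.single x 1) y < a y" for y
          using m(2) x(2) a[of y] unfolding standard_exponents_def
          by (auto simp: lookup_add lookup_single when_def in_keys_iff)
        ultimately show False using bad[of x] keys[of x] unfolding standard_exponents_def by simp
      qed
      then have "Poly_Mapping.keys m \<in> facets \<Delta>" using face unfolding facets_def by blast
      then have "monomial_degree m = D"
        unfolding monomial_degree_def using D full by simp
      then show False using p m d by (auto simp: homogeneous_polys_def)
    qed
    then show "p \<in> ?I" unfolding I by blast
  qed
qed

theorem theorem4p9:
  fixes \<Delta> :: "'x::finite set set"
  assumes "simplicial_complex UNIV \<Delta>"
    and "\<forall>F\<in>facets \<Delta>. card F \<noteq> 1"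
    and "simplicial_forest \<Delta>"
  shows "levelable TYPE('k::field_char_0) \<Delta>"
proof -
  have "\<exists>(b :: 'x \<Rightarrow> nat) c. (\<forall>x. b x \<ge> 1) \<and> (\<forall>F\<in>facets \<Delta>. sum b F = c)"
    using assms(3) unfolding simplicial_forest_def
    by (intro balanced_weight_exists) (auto simp: facets_def)
  then obtain b :: "'x \<Rightarrow> nat" and c
    where b: "\<And>x. b x \<ge> 1" "\<And>F. F \<in> facets \<Delta> \<Longrightarrow> sum b F = c" by blast
  \<comment> \<open>Taking \<open>a = b + 1\<close> makes \<open>a x - 1\<close> the balanced
    weight, and positivity of \<open>b\<close> gives \<open>a x \<ge> 2\<close>.\<close>
  have "level (A_ideal \<Delta> (\<lambda>x. b x + 1) :: ('x, 'k) mpoly set)"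
    using b by (intro level_A_ideal[OF assms(1), where D = c]) (auto simp: Suc_le_eq)
  then show ?thesis
    unfolding levelable_def using b(1) by (intro exI[of _ "\<lambda>x. b x + 1"]) (auto simp: Suc_le_eq)
qed

end
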